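(* Let $\omega:[0,\infty)\to[0,\infty)$ be a non-decreasing continuous function such that $\omega(t)=0$ implies $t=0$. Let $y:[0,\infty)\to[0,\infty)$ be a continuous function with $$\int_0^\infty \omega(y(t))\varphi(t)\,dt<\infty,$$ where $\varphi:[0,\infty)\to[0,\infty)$ is a continuous function, with $\varphi(t)>0$ for all sufficiently large $t$, for which there exists a constant $C>0$ such that $$\lim_{t\to\infty}\Big(t-\frac{C}{\varphi(t)}\Big)=\infty,\qquad M:=\limsup_{t\to\infty}\frac{\max_{\xi\in[t-\frac{C}{\varphi(t)},\,t]}\varphi(\xi)}{\min_{\xi\in[t-\frac{C}{\varphi(t)},\,t]}\varphi(\xi)}<\infty .$$ Let $f(x,y)\ge 0$ be a continuous function on $[0,\infty)\times[0,\infty)$ such that $$y(t)-y(s)\le\int_s^t f(\xi,y(\xi))\,d\xi,\qquad 0\le s\le t.$$ If there exist constants $a>0$ and $\theta>0$ such that $$\int_s^t \sup_{0\le\zeta\le a} f(x,\zeta)\,dx\le (t-s)\,\theta a\max_{\xi\in[s,t]}\varphi(\xi)\qquad\text{for all } t>s\gg 1,$$ then $$\lim_{t\to\infty}y(t)=0.$$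
   Context: The notation "for all $t>s\gg1$" means: there exists $S>0$ such that the inequality holds for all $s,t$ with $t>s\ge S$. *)

theory Defs
  imports "HOL-Analysis.Analysis"
begin

end

theory Submission
  imports Defs
begin

text \<open>
  The integral of \<open>\<omega> (y t) * \<phi> t\<close> converges, so its value over any interval far enough to the
  right is as small as desired. It therefore suffices to show that every large \<open>t\<close> with
  \<open>y t \<ge> \<epsilon>\<close>, where \<open>0 < \<epsilon> \<le> a\<close>, forces the integral over some subinterval of the window
  \<open>[t - C / \<phi> t, t]\<close> to be at least a positive constant that depends on \<open>\<epsilon>\<close> but not on \<open>t\<close>.

  By the limsup condition (\<open>window_comparable\<close>), \<open>\<phi>\<close> is comparable on the window to its value
  at the right endpoint, with a factor \<open>K\<close> uniform in \<open>t\<close>. There are two cases. If \<open>y \<ge> \<epsilon>/2\<close> on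
  the whole window, the integrand is at least \<open>\<omega> (\<epsilon>/2) * \<phi> t / K\<close> on a set of length \<open>C / \<phi> t\<close>,
  and \<open>\<phi> t\<close> cancels. Otherwise \<open>y\<close> climbs from \<open>\<epsilon>/2\<close> to \<open>\<epsilon>\<close> inside the window while staying
  between these levels (\<open>climb_between_levels\<close>). As \<open>\<epsilon> \<le> a\<close>, the bound on the supremum of \<open>f\<close>
  limits the speed of the climb to \<open>\<theta> * a * K * \<phi> t\<close>, so the climb lasts at least
  \<open>\<epsilon> / (2 * \<theta> * a * K * \<phi> t)\<close>, and \<open>\<phi> t\<close> cancels once more.
\<close>

section \<open>Suprema, improper integrals and level crossings\<close>

text \<open>
  Compactness of \<open>B\<close> makes the continuity in \<open>x\<close> uniform in \<open>z\<close>, and two functions of \<open>z\<close>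
  that differ by at most \<open>e\<close> everywhere have suprema that differ by at most \<open>e\<close>.
\<close>
lemma continuous_on_SUP_compact:
  fixes f :: "'a::topological_space \<Rightarrow> 'b::topological_space \<Rightarrow> real"
  assumes cont: "continuous_on (A \<times> B) (\<lambda>(x, z). f x z)"
    and B: "compact B" "B \<noteq> {}"
  shows "continuous_on A (\<lambda>x. SUP z\<in>B. f x z)"
proof -
  have slice: "continuous_on B (f x)" if "x \<in> A" for x
  proof -
    have "continuous_on B ((\<lambda>(x, z). f x z) \<circ> (\<lambda>z. (x, z)))"
      by (intro continuous_on_compose continuous_intros continuous_on_subset[OF cont])
        (use that in auto)
    then show ?thesis by (simp add: o_def)
  qed
  have bdd: "bdd_above (f x ` B)" if "x \<in> A" for x
    using slice[OF that] B(1) compact_continuous_image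
    by (metis bounded_imp_bdd_above compact_imp_bounded)
  have close: "(SUP z\<in>B. f x z) \<le> (SUP z\<in>B. f x' z) + e"
    if "x \<in> A" "x' \<in> A" "\<forall>z\<in>B. dist (f x z) (f x' z) \<le> e" for x x' e
  proof (rule cSUP_least[OF B(2)])
    fix z assume z: "z \<in> B"
    have "f x z \<le> f x' z + e" using that(3) z by (auto simp: dist_real_def abs_le_iff)
    also have "f x' z \<le> (SUP z\<in>B. f x' z)" by (rule cSUP_upper[OF z bdd[OF that(2)]])
    finally show "f x z \<le> (SUP z\<in>B. f x' z) + e" by simp
  qed
  show ?thesis
    unfolding continuous_on_def
  proof (intro ballI tendstoI)
    fix x0 and e :: real assume x0: "x0 \<in> A" and e: "e > 0"
    obtain X where X: "x0 \<in> X" "open X"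
        "\<forall>x\<in>X \<inter> A. \<forall>z\<in>B. dist (f x z) (f x0 z) \<le> e / 2"
      by (rule continuous_on_prod_compactE[OF cont B(1) x0, of "e / 2"])
        (simp_all only: split_conv half_gt_zero[OF e])
    have "dist (SUP z\<in>B. f x z) (SUP z\<in>B. f x0 z) < e" if "x \<in> X" "x \<in> A" for x
    proof -
      have *: "\<forall>z\<in>B. dist (f x z) (f x0 z) \<le> e / 2" using X(3) that by blast
      then have "\<forall>z\<in>B. dist (f x0 z) (f x z) \<le> e / 2" by (simp add: dist_commute)
      with * show ?thesis
        using close[of x x0 "e / 2"] close[of x0 x "e / 2"] that(2) x0 e
        by (simp add: dist_real_def abs_less_iff)
    qed
    then show "\<forall>\<^sub>F x in at x0 within A. dist (SUP z\<in>B. f x z) (SUP z\<in>B. f x0 z) < e"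
      unfolding eventually_at_topological using X by blast
  qed
qed

text \<open>
  Cauchy's criterion for a convergent improper integral. Extend \<open>g\<close> by zero to the line: its
  integrals over all compact intervals that contain a suitable ball \<open>(-B, B)\<close> are close to the
  full integral, and the integrals over \<open>[-B, q]\<close> and \<open>[-B, p]\<close> differ by the one over \<open>[p, q]\<close>.
\<close>
lemma integral_tail_small:
  fixes g :: "real \<Rightarrow> 'a::banach"
  assumes "g integrable_on {0..}" "e > 0"
  obtains T where "T \<ge> 0" "\<And>p q. T \<le> p \<Longrightarrow> p \<le> q \<Longrightarrow> norm (integral {p..q} g) < e"
proof -
  define h where "h = (\<lambda>x. if x \<in> {0..} then g x else 0)"
  obtain i where i: "(g has_integral i) {0..}" using assms by blast
  have int: "h integrable_on cbox a b" for a b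
    using i unfolding has_integral_alt' h_def by blast
  obtain B where B: "B > 0"
      "\<And>a b. ball 0 B \<subseteq> cbox a b \<Longrightarrow> norm (integral (cbox a b) h - i) < e / 2"
    using i assms(2) unfolding has_integral_alt' h_def by (meson half_gt_zero)
  have "norm (integral {p..q} g) < e" if "B \<le> p" "p \<le> q" for p q
  proof -
    have near: "norm (integral {-B..b} h - i) < e / 2" if "b \<ge> B" for b
    proof -
      have "ball 0 B \<subseteq> cbox (-B) b"
        using that by (auto simp: abs_less_iff)
      from B(2)[OF this] show ?thesis by simp
    qed
    have "integral {-B..p} h + integral {p..q} h = integral {-B..q} h"
      using that B(1) int[of "-B" q] by (intro Henstock_Kurzweil_Integration.integral_combine) auto
    moreover have "integral {p..q} h = integral {p..q} g"
      using that B(1) by (intro integral_cong) (auto simp: h_def)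
    ultimately have "integral {p..q} g = (integral {-B..q} h - i) - (integral {-B..p} h - i)"
      by (simp add: algebra_simps)
    then show ?thesis
      using near[of p] near[of q] that
        norm_triangle_ineq4[of "integral {-B..q} h - i" "integral {-B..p} h - i"]
      by simp
  qed
  then show ?thesis using B(1) by (intro that[of B]) auto
qed

text \<open>
  The witnesses are the first point \<open>q\<close> at which \<open>y\<close> takes the upper level and the last point
  \<open>p\<close> before \<open>q\<close> at which it takes the lower level; leaving the strip between them would
  produce, by the intermediate value theorem, an earlier or a later such point.
\<close>
lemma climb_between_levels:
  fixes y :: "real \<Rightarrow> real"
  assumes cont: "continuous_on {u..t} y" and "u \<le> t"
    and lo: "y u \<le> lo" and hi: "hi \<le> y t" and "lo \<le> hi"
  obtains p q where "u \<le> p" "p \<le> q" "q \<le> t" "y p = lo" "y q = hi"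
    "\<And>x. x \<in> {p..q} \<Longrightarrow> lo \<le> y x \<and> y x \<le> hi"
proof -
  have compact_level: "compact {x \<in> {u..b}. y x = c}" if "b \<le> t" for b c
  proof -
    have "continuous_on {u..b} y"
      by (rule continuous_on_subset[OF cont]) (use that in auto)
    then have "closed {x \<in> {u..b}. y x = c}"
      by (rule continuous_closed_preimage_constant) simp
    moreover have "{x \<in> {u..b}. y x = c} \<subseteq> {u..b}" by blast
    ultimately show ?thesis
      using bounded_subset[OF bounded_closed_interval] compact_eq_bounded_closed by blast
  qed
  have IVT: "\<exists>x\<ge>l. x \<le> r \<and> y x = c"
    if "u \<le> l" "l \<le> r" "r \<le> t" "y l \<le> c" "c \<le> y r" for l r c
    using IVT'[of y l c r] that continuous_on_subset[OF cont, of "{l..r}"] by auto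
  have "{x \<in> {u..t}. y x = hi} \<noteq> {}"
    using IVT[of u t hi] assms by auto
  then obtain q where q: "u \<le> q" "q \<le> t" "y q = hi"
      and first: "\<And>x. u \<le> x \<Longrightarrow> x \<le> t \<Longrightarrow> y x = hi \<Longrightarrow> q \<le> x"
    using compact_attains_inf[OF compact_level[of t hi]] by auto
  have "{x \<in> {u..q}. y x = lo} \<noteq> {}"
    using IVT[of u q lo] assms q by auto
  then obtain p where p: "u \<le> p" "p \<le> q" "y p = lo"
      and last: "\<And>x. u \<le> x \<Longrightarrow> x \<le> q \<Longrightarrow> y x = lo \<Longrightarrow> x \<le> p"
    using compact_attains_sup[OF compact_level[of q lo]] q by auto
  have "lo \<le> y x \<and> y x \<le> hi" if x: "x \<in> {p..q}" for x
  proof (intro conjI; rule ccontr)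
    assume less: "\<not> lo \<le> y x"
    then obtain x' where "x \<le> x'" "x' \<le> q" "y x' = lo"
      using IVT[of x q lo] x p q assms by auto
    with last[of x'] x p(1) have "x = p" by simp
    with less p(3) show False by simp
  next
    assume greater: "\<not> y x \<le> hi"
    then obtain x' where "p \<le> x'" "x' \<le> x" "y x' = hi"
      using IVT[of p x hi] x p q assms by auto
    with first[of x'] x p(1) q(2) have "x = q" by simp
    with greater q(3) show False by simp
  qed
  with p q show ?thesis using that by blast
qed

section \<open>Estimates on a window\<close>

text \<open>
  The limsup bounds the ratio of the maximum to the minimum over the window, and \<open>\<phi> t\<close> lies
  between these two. The window eventually lies where \<open>\<phi>\<close> is positive, so the minimum, which
  is attained, is positive and the quotient is meaningful.
\<close>
lemma window_comparable:
  fixes \<phi> :: "real \<Rightarrow> real"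
  assumes cont: "continuous_on {0..} \<phi>"
    and pos: "eventually (\<lambda>t. \<phi> t > 0) at_top"
    and C: "C > 0" and lim: "filterlim (\<lambda>t. t - C / \<phi> t) at_top at_top"
    and limsup: "Limsup at_top (\<lambda>t. ereal
          ((SUP \<xi>\<in>{t - C / \<phi> t..t}. \<phi> \<xi>) / (INF \<xi>\<in>{t - C / \<phi> t..t}. \<phi> \<xi>))) < \<infinity>"
  obtains K where "K > 0"
    "\<forall>\<^sub>F t in at_top. \<forall>\<xi>\<in>{t - C / \<phi> t..t}. \<phi> t \<le> K * \<phi> \<xi> \<and> \<phi> \<xi> \<le> K * \<phi> t"
proof -
  obtain K0 where K0: "Limsup at_top (\<lambda>t. ereal
      ((SUP \<xi>\<in>{t - C / \<phi> t..t}. \<phi> \<xi>) / (INF \<xi>\<in>{t - C / \<phi> t..t}. \<phi> \<xi>))) < ereal K0"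
    using ereal_dense2[OF limsup] by blast
  define K where "K = max K0 1"
  obtain S where S: "\<And>t. t \<ge> S \<Longrightarrow> \<phi> t > 0"
    using pos unfolding eventually_at_top_linorder by blast
  have "\<forall>\<^sub>F t in at_top. t - C / \<phi> t \<ge> max S 0"
    using lim unfolding filterlim_at_top by blast
  with Limsup_lessD[OF K0] pos
  have "\<forall>\<^sub>F t in at_top. \<forall>\<xi>\<in>{t - C / \<phi> t..t}. \<phi> t \<le> K * \<phi> \<xi> \<and> \<phi> \<xi> \<le> K * \<phi> t"
  proof eventually_elim
    case (elim t)
    define W where "W = {t - C / \<phi> t..t}"
    have tW: "t \<in> W" using elim C by (simp add: W_def)
    have cont': "continuous_on W \<phi>"
      by (rule continuous_on_subset[OF cont]) (use elim in \<open>auto simp: W_def\<close>)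
    have compact_img: "compact (\<phi> ` W)"
      using cont' by (auto simp: W_def intro: compact_continuous_image)
    then have bdd: "bdd_above (\<phi> ` W)" "bdd_below (\<phi> ` W)"
      by (auto intro: bounded_imp_bdd_above bounded_imp_bdd_below compact_imp_bounded)
    obtain m where m: "m \<in> W" "\<forall>\<xi>\<in>W. \<phi> m \<le> \<phi> \<xi>"
      using continuous_attains_inf[of W \<phi>] cont' tW by (auto simp: W_def)
    have "(INF \<xi>\<in>W. \<phi> \<xi>) = \<phi> m"
      using m by (intro cInf_eq_minimum) auto
    moreover have "\<phi> m > 0" using m(1) elim S by (auto simp: W_def)
    moreover have "(SUP \<xi>\<in>W. \<phi> \<xi>) / (INF \<xi>\<in>W. \<phi> \<xi>) < K"
      using elim(1) by (simp add: W_def K_def)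
    ultimately have sup_le: "(SUP \<xi>\<in>W. \<phi> \<xi>) \<le> K * \<phi> m"
      by (simp add: field_simps)
    have ratio: "\<phi> \<xi> \<le> K * \<phi> \<eta>" if "\<xi> \<in> W" "\<eta> \<in> W" for \<xi> \<eta>
    proof -
      have "\<phi> \<xi> \<le> (SUP \<xi>\<in>W. \<phi> \<xi>)" by (rule cSUP_upper[OF that(1) bdd(1)])
      also note sup_le
      also have "K * \<phi> m \<le> K * \<phi> \<eta>"
        using m(2) that(2) by (intro mult_left_mono) (auto simp: K_def)
      finally show ?thesis .
    qed
    then show ?case using tW by (auto simp: W_def[symmetric])
  qed
  then show ?thesis by (intro that[of K]) (auto simp: K_def)
qed

text \<open>
  The hypothesis on \<open>f\<close> controls the growth of \<open>y\<close> only while \<open>y\<close> stays in \<open>[0, a]\<close>, where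
  \<open>f x (y x)\<close> is one of the values over which the supremum is taken.
\<close>
lemma growth_le_SUP_integral:
  fixes f :: "real \<Rightarrow> real \<Rightarrow> real"
  assumes f_cont: "continuous_on ({0..} \<times> {0..}) (\<lambda>(x, z). f x z)"
    and y_cont: "continuous_on {0..} y" and "0 \<le> p"
    and range: "\<And>x. x \<in> {p..q} \<Longrightarrow> y x \<in> {0..a}" and "a \<ge> 0"
  shows "integral {p..q} (\<lambda>x. f x (y x)) \<le> integral {p..q} (\<lambda>x. SUP \<zeta>\<in>{0..a}. f x \<zeta>)"
proof (rule integral_le)
  have "continuous_on {p..q} ((\<lambda>(x, z). f x z) \<circ> (\<lambda>x. (x, y x)))"
    by (intro continuous_on_compose continuous_intros continuous_on_subset[OF f_cont]
        continuous_on_subset[OF y_cont]) (use assms in force)+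
  then show "(\<lambda>x. f x (y x)) integrable_on {p..q}"
    by (intro integrable_continuous_interval) (simp add: o_def)
  have f_cont': "continuous_on ({p..q} \<times> {0..a}) (\<lambda>(x, z). f x z)"
    by (rule continuous_on_subset[OF f_cont]) (use \<open>0 \<le> p\<close> in auto)
  then show "(\<lambda>x. SUP \<zeta>\<in>{0..a}. f x \<zeta>) integrable_on {p..q}"
    using \<open>a \<ge> 0\<close> by (intro integrable_continuous_interval continuous_on_SUP_compact) auto
  fix x assume x: "x \<in> {p..q}"
  have "continuous_on {0..a} ((\<lambda>(x, z). f x z) \<circ> (\<lambda>z. (x, z)))"
    by (intro continuous_on_compose continuous_intros continuous_on_subset[OF f_cont'])
      (use x in auto)
  then have "compact (f x ` {0..a})"
    by (intro compact_continuous_image) (auto simp: o_def)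
  then have "bdd_above (f x ` {0..a})"
    by (intro bounded_imp_bdd_above compact_imp_bounded)
  then show "f x (y x) \<le> (SUP \<zeta>\<in>{0..a}. f x \<zeta>)"
    by (rule cSUP_upper[OF range[OF x]])
qed

section \<open>Decay of \<open>y\<close>\<close>

theorem theorem2p4:
  fixes \<omega> y \<phi> :: "real \<Rightarrow> real"
    and f :: "real \<Rightarrow> real \<Rightarrow> real"
    and C a \<theta> :: real
  assumes omega_nonneg: "\<And>t. t \<ge> 0 \<Longrightarrow> \<omega> t \<ge> 0"
    and omega_mono: "mono_on {0..} \<omega>"
    and omega_cont: "continuous_on {0..} \<omega>"
    and omega_zero: "\<And>t. t \<ge> 0 \<Longrightarrow> \<omega> t = 0 \<Longrightarrow> t = 0"
    and y_nonneg: "\<And>t. t \<ge> 0 \<Longrightarrow> y t \<ge> 0"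
    and y_cont: "continuous_on {0..} y"
    and phi_nonneg: "\<And>t. t \<ge> 0 \<Longrightarrow> \<phi> t \<ge> 0"
    and phi_cont: "continuous_on {0..} \<phi>"
    and phi_pos: "eventually (\<lambda>t. \<phi> t > 0) at_top"
    and integral_finite: "(\<lambda>t. \<omega> (y t) * \<phi> t) integrable_on {0..}"
    and C_pos: "C > 0"
    and C_lim: "filterlim (\<lambda>t. t - C / \<phi> t) at_top at_top"
    and C_limsup: "Limsup at_top (\<lambda>t. ereal
          ((SUP \<xi>\<in>{t - C / \<phi> t..t}. \<phi> \<xi>) / (INF \<xi>\<in>{t - C / \<phi> t..t}. \<phi> \<xi>))) < \<infinity>"
    and f_nonneg: "\<And>x z. x \<ge> 0 \<Longrightarrow> z \<ge> 0 \<Longrightarrow> f x z \<ge> 0"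
    and f_cont: "continuous_on ({0..} \<times> {0..}) (\<lambda>(x, z). f x z)"
    and y_ineq: "\<And>s t. 0 \<le> s \<Longrightarrow> s \<le> t \<Longrightarrow>
          y t - y s \<le> integral {s..t} (\<lambda>\<xi>. f \<xi> (y \<xi>))"
    and a_pos: "a > 0"
    and theta_pos: "\<theta> > 0"
    and f_bound: "\<exists>S>0. \<forall>s t. S \<le> s \<and> s < t \<longrightarrow>
          integral {s..t} (\<lambda>x. SUP \<zeta>\<in>{0..a}. f x \<zeta>)
            \<le> (t - s) * \<theta> * a * (SUP \<xi>\<in>{s..t}. \<phi> \<xi>)"
  shows "(y \<longlongrightarrow> 0) at_top"
proof -
  obtain K where K: "K > 0" and window:
      "\<forall>\<^sub>F t in at_top. \<forall>\<xi>\<in>{t - C / \<phi> t..t}. \<phi> t \<le> K * \<phi> \<xi> \<and> \<phi> \<xi> \<le> K * \<phi> t"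
    using window_comparable[OF phi_cont phi_pos C_pos C_lim C_limsup] by blast
  obtain S where S: "S > 0" and bound: "\<And>s t. S \<le> s \<Longrightarrow> s < t \<Longrightarrow>
      integral {s..t} (\<lambda>x. SUP \<zeta>\<in>{0..a}. f x \<zeta>) \<le> (t - s) * \<theta> * a * (SUP \<xi>\<in>{s..t}. \<phi> \<xi>)"
    using f_bound by blast
  have small: "\<forall>\<^sub>F t in at_top. y t < \<epsilon>" if \<epsilon>: "0 < \<epsilon>" "\<epsilon> \<le> a" for \<epsilon>
  proof -
    define w where "w = \<omega> (\<epsilon> / 2)"
    have w: "w > 0"
      using omega_nonneg[of "\<epsilon> / 2"] omega_zero[of "\<epsilon> / 2"] \<epsilon> by (force simp: w_def)
    \<comment> \<open>If \<open>y t \<ge> \<epsilon>\<close>, then \<open>y \<ge> \<epsilon> / 2\<close> on an interval of length at least \<open>d / \<phi> t\<close>: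
      the first entry is for the whole window, the second for a climb from \<open>\<epsilon> / 2\<close> to \<open>\<epsilon>\<close>.\<close>
    define d where "d = min C (\<epsilon> / (2 * \<theta> * a * K))"
    have d: "d > 0" using C_pos \<epsilon> theta_pos a_pos K by (simp add: d_def)
    have "w * d / K > 0" using w d K by simp
    then obtain T where T: "T \<ge> 0" and tail: "\<And>p q. T \<le> p \<Longrightarrow> p \<le> q \<Longrightarrow>
        norm (integral {p..q} (\<lambda>t. \<omega> (y t) * \<phi> t)) < w * d / K"
      using integral_tail_small[OF integral_finite] by blast
    have "\<forall>\<^sub>F t in at_top. t - C / \<phi> t \<ge> max S T"
      using C_lim unfolding filterlim_at_top by blast
    with window phi_pos show ?thesis
    proof eventually_elim
      case (elim t)
      define u where "u = t - C / \<phi> t"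
      have u: "S \<le> u" "T \<le> u" "u \<le> t" using elim C_pos by (auto simp: u_def)
      \<comment> \<open>A longer interval would carry a share \<open>w * d / K\<close> of the integral, against the choice
        of \<open>T\<close>.\<close>
      have short: "q - p < d / \<phi> t"
        if pq: "u \<le> p" "p \<le> q" "q \<le> t" and above: "\<And>x. x \<in> {p..q} \<Longrightarrow> \<epsilon> / 2 \<le> y x" for p q
      proof -
        have "w * (\<phi> t / K) \<le> \<omega> (y x) * \<phi> x" if x: "x \<in> {p..q}" for x
        proof (rule mult_mono)
          show "w \<le> \<omega> (y x)"
            using omega_mono above[OF x] \<epsilon> unfolding w_def by (auto simp: mono_on_def)
          then show "0 \<le> \<omega> (y x)" using w by simp
          show "\<phi> t / K \<le> \<phi> x" using elim(1) x pq K by (auto simp: u_def field_simps)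
          show "0 \<le> \<phi> t / K" using elim(2) K by simp
        qed
        then have "integral {p..q} (\<lambda>x. w * (\<phi> t / K)) \<le> integral {p..q} (\<lambda>x. \<omega> (y x) * \<phi> x)"
          using pq u T by (intro integral_le integrable_on_subinterval[OF integral_finite]) auto
        also have "\<dots> < w * d / K"
          using tail[of p q] pq u by simp
        also have "integral {p..q} (\<lambda>x. w * (\<phi> t / K)) = (q - p) * (w * (\<phi> t / K))"
          using integral_const_real[of p q "w * (\<phi> t / K)"] pq by (simp only: real_scaleR_def) simp
        also have "\<dots> = (w / K) * ((q - p) * \<phi> t)"
          by (simp only: divide_inverse ac_simps)
        also have "w * d / K = (w / K) * d"
          by (simp only: divide_inverse ac_simps)
        finally have "(w / K) * ((q - p) * \<phi> t) < (w / K) * d" .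
        then have "(q - p) * \<phi> t < d"
          by (rule mult_left_less_imp_less) (use w K in simp)
        then show ?thesis
          using elim(2) by (simp add: pos_less_divide_eq)
      qed
      show "y t < \<epsilon>"
      proof (rule ccontr)
        assume "\<not> y t < \<epsilon>"
        have "\<exists>x\<in>{u..t}. y x < \<epsilon> / 2"
        proof (rule ccontr)
          assume "\<not> (\<exists>x\<in>{u..t}. y x < \<epsilon> / 2)"
          then have "t - u < d / \<phi> t" using u by (intro short) (auto simp: not_less)
          then show False
            using elim(2) by (simp add: u_def d_def divide_less_cancel)
        qed
        then obtain v where v: "u \<le> v" "v \<le> t" "y v < \<epsilon> / 2" by auto
        have "continuous_on {v..t} y"
          by (rule continuous_on_subset[OF y_cont]) (use u v S in auto)
        then obtain p q where pq: "v \<le> p" "p \<le> q" "q \<le> t" "y p = \<epsilon> / 2" "y q = \<epsilon>"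
            and strip: "\<And>x. x \<in> {p..q} \<Longrightarrow> \<epsilon> / 2 \<le> y x \<and> y x \<le> \<epsilon>"
          using climb_between_levels[of v t y "\<epsilon> / 2" \<epsilon>] v \<epsilon> \<open>\<not> y t < \<epsilon>\<close> by auto
        have "p < q" using pq \<epsilon> by (cases "p = q") auto
        have "\<epsilon> / 2 \<le> integral {p..q} (\<lambda>\<xi>. f \<xi> (y \<xi>))"
          using y_ineq[of p q] pq v u S by simp
        also have "\<dots> \<le> integral {p..q} (\<lambda>x. SUP \<zeta>\<in>{0..a}. f x \<zeta>)"
          using strip \<epsilon> a_pos pq v u S
          by (intro growth_le_SUP_integral[OF f_cont y_cont]) force+
        also have "\<dots> \<le> (q - p) * \<theta> * a * (SUP \<xi>\<in>{p..q}. \<phi> \<xi>)"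
          using bound \<open>p < q\<close> pq v u by simp
        also have "\<dots> \<le> (q - p) * \<theta> * a * (K * \<phi> t)"
          using elim(1) \<open>p < q\<close> pq v theta_pos a_pos
          by (intro mult_left_mono cSUP_least) (auto simp: u_def)
        finally have "\<epsilon> / (2 * \<theta> * a * K) \<le> (q - p) * \<phi> t"
          using theta_pos a_pos K by (simp add: field_simps)
        moreover have "q - p < d / \<phi> t"
          using pq v strip by (intro short) auto
        then have "(q - p) * \<phi> t < d" using elim(2) by (simp add: field_simps)
        ultimately show False by (simp add: d_def)
      qed
    qed
  qed
  show ?thesis
  proof (rule tendstoI)
    fix e :: real assume "e > 0"
    then have "\<forall>\<^sub>F t in at_top. y t < min e a" using small[of "min e a"] a_pos by simp
    with eventually_ge_at_top[of 0] show "\<forall>\<^sub>F t in at_top. dist (y t) 0 < e"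
      by eventually_elim (use y_nonneg in auto)
  qed
qed

end
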